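(* Let $N=RQ$ be a squarefree odd positive integer ($R,Q$ positive integers) with $R\equiv1\bmod 2Q^2$. Let $v,u\in\mathcal{S}(\mathbb{R})$ be such that $x>0$ and $0<x^2-y^2<8$ whenever $v(x)u(y)\neq0$. Then $$\big(v\,\big|\,\Psi(Q^{2i\pi\mathcal{E}}\mathfrak{T}_N)\,u\big)=\sum_{Q_1Q_2=Q}\mu(Q_1)\sum_{R_1|R}\mu(R_1)\,\overline{v}\!\left(\frac{R_1}{Q_2}+\frac{Q_2}{R_1}\right)u\!\left(\frac{R_1}{Q_2}-\frac{Q_2}{R_1}\right),$$ where $Q_1,Q_2,R_1$ range over positive integers.
   Context: $\mu$ is the Möbius function. For $j\ge1$, $a(j)=\prod_{p\text{ prime},\,p|j}(1-p)$, and $\mathfrak{T}_N(x,\xi)=\sum_{j,k\in\mathbb{Z}}a(\gcd(j,k,N))\,\delta(x-j)\delta(\xi-k)$ (with $\gcd(0,0,N)=N$). For $\mathfrak{S}\in\mathcal{S}'(\mathbb{R}^2)$, $\Psi(\mathfrak{S})$ is the operator weakly defined by $(\Psi(\mathfrak{S})u)(x)=\frac12\int_{\mathbb{R}^2}\mathfrak{S}(\frac{x+y}{2},\xi)e^{i\pi(x-y)\xi}u(y)\,dy\,d\xi$, and $(v|w)=\int_{\mathbb{R}}\overline{v}w$. For $Q>0$, $(Q^{2i\pi\mathcal{E}}\mathfrak{S})(x,\xi)=Q\,\mathfrak{S}(Qx,Q\xi)$. *)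

theory Defs
  imports "HOL-Analysis.Analysis" "HOL-Number_Theory.Number_Theory"
    "HOL-Computational_Algebra.Squarefree"
begin

definition moebius_mu :: "nat \<Rightarrow> int" where
  "moebius_mu n = (if squarefree n then (-1) ^ card (prime_factors n) else 0)"

definition a_coeff :: "nat \<Rightarrow> int" where
  "a_coeff j = (\<Prod>p\<in>{p. prime p \<and> p dvd j}. 1 - int p)"

definition vderiv :: "(real \<Rightarrow> complex) \<Rightarrow> real \<Rightarrow> complex" where
  "vderiv f x = vector_derivative f (at x)"

definition schwartz :: "(real \<Rightarrow> complex) \<Rightarrow> bool" where
  "schwartz f \<longleftrightarrow>
     (\<forall>n x. (vderiv ^^ n) f differentiable (at x)) \<and>
     (\<forall>m n. bounded (range (\<lambda>x. x ^ m *\<^sub>R (vderiv ^^ n) f x)))"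

text \<open>A distribution is represented by its action on test functions. The pairing
  \<open>\<langle>S, h\<rangle>\<close> is bilinear, formally \<open>\<integral> S h\<close>, without complex conjugation. Only the values
  at Schwartz functions \<open>h\<close> are meaningful.\<close>

type_synonym 'a distr = "('a \<Rightarrow> complex) \<Rightarrow> complex"

definition T_distr :: "nat \<Rightarrow> (real \<times> real) distr" where
  "T_distr N h =
     (\<Sum>\<^sub>\<infinity>(j, k)\<in>(UNIV :: (int \<times> int) set).
        of_int (a_coeff (nat (gcd (gcd j k) (int N)))) * h (of_int j, of_int k))"

text \<open>\<open>S(x, \<xi>) \<mapsto> c S(c x, c \<xi>)\<close>; moving the dilation to the test function
  produces the Jacobian \<open>c\<^sup>-\<^sup>2\<close>.\<close>

definition dilate :: "real \<Rightarrow> (real \<times> real) distr \<Rightarrow> (real \<times> real) distr" where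
  "dilate c S h = of_real c * (S (\<lambda>(x, \<xi>). h (x / c, \<xi> / c)) / of_real (c\<^sup>2))"

text \<open>The operator \<open>\<Psi>(S)\<close> sends \<open>u\<close> to the distribution \<open>\<Psi>(S) u\<close> on the line. Pairing the
  defining integral
  \<open>1/2 \<integral>\<integral> S((x + y)/2, \<xi>) exp(\<i> \<pi> (x - y) \<xi>) u(y) dy d\<xi>\<close>
  with \<open>w(x)\<close> and substituting \<open>x = X + t\<close>, \<open>y = X - t\<close> (so \<open>dx dy = 2 dX dt\<close>, which absorbs
  the factor \<open>1/2\<close>) leaves \<open>S\<close> paired with a test function of \<open>(X, \<xi>)\<close>.
  The lemma \<open>sesq_Psi_function\<close> below checks this against the integral when \<open>S\<close> is an
  integrable function.\<close>

definition Psi :: "(real \<times> real) distr \<Rightarrow> (real \<Rightarrow> complex) \<Rightarrow> real distr" where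
  "Psi S u w =
     S (\<lambda>(x, \<xi>). LINT t|lborel. w (x + t) * u (x - t) * exp (2 * \<i> * of_real (pi * t * \<xi>)))"

text \<open>\<open>(v | T) = \<integral> cnj v T\<close>, antilinear in the first argument.\<close>

definition sesq :: "(real \<Rightarrow> complex) \<Rightarrow> real distr \<Rightarrow> complex" where
  "sesq v T = T (\<lambda>x. cnj (v x))"

lemma sesq_Psi_function:
  fixes f :: "real \<times> real \<Rightarrow> complex" and v u :: "real \<Rightarrow> complex"
  assumes f: "integrable lborel f" and v: "integrable lborel v"
    and u: "u \<in> borel_measurable borel" "bounded (range u)"
  shows "sesq v (Psi (\<lambda>h. LINT p|lborel. f p * h p) u) =
    (LINT x|lborel. cnj (v x) *
       (1 / 2 * (LINT (y, \<xi>)|lborel.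
          f ((x + y) / 2, \<xi>) * exp (\<i> * of_real (pi * (x - y) * \<xi>)) * u y)))"
proof -
  define w where "w = (\<lambda>x. cnj (v x))"
  have w: "integrable lborel w" unfolding w_def using v by simp
  have [measurable]: "f \<in> borel_measurable borel" "w \<in> borel_measurable borel"
    "u \<in> borel_measurable borel"
    using f w u by (auto dest: borel_measurable_integrable)
  define E where "E = (\<lambda>s::real. exp (\<i> * of_real s) :: complex)"
  have [measurable]: "E \<in> borel_measurable borel" unfolding E_def
    by (intro borel_measurable_continuous_onI continuous_intros)
  have E1: "norm (E s) = 1" for s unfolding E_def by (simp add: norm_exp_i_times)
  obtain B where B: "\<And>y. norm (u y) \<le> B" using u(2) by (auto simp: bounded_iff)
  have B0: "0 \<le> B" using B[of 0] norm_ge_zero order_trans by blast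
  define F where "F = (\<lambda>(p::real \<times> real) x.
     f p * (w x * u (2 * fst p - x) * E (2 * pi * (x - fst p) * snd p)))"
  have EM: "(\<lambda>z. E (g z)) \<in> borel_measurable borel"
    if "continuous_on UNIV g" for g :: "'c :: topological_space \<Rightarrow> real"
    using that unfolding E_def by (intro borel_measurable_continuous_onI continuous_intros)
  have uM: "(\<lambda>z. u (g z)) \<in> borel_measurable borel"
    if "continuous_on UNIV g" for g :: "'c :: topological_space \<Rightarrow> real"
    using measurable_compose[OF borel_measurable_continuous_onI[OF that] u(1)] .
  have sets_eq: "sets (lborel \<Otimes>\<^sub>M lborel) = sets (borel :: ((real \<times> real) \<times> real) measure)"
    by (simp add: borel_prod[symmetric] cong: sets_pair_measure_cong)
  have fM: "(\<lambda>z. f (fst z)) \<in> borel_measurable (borel :: ((real \<times> real) \<times> real) measure)"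
    by (rule measurable_compose[OF borel_measurable_continuous_onI]) (auto intro: continuous_intros)
  have wM: "(\<lambda>z. w (snd z)) \<in> borel_measurable (borel :: ((real \<times> real) \<times> real) measure)"
    by (rule measurable_compose[OF borel_measurable_continuous_onI]) (auto intro: continuous_intros)
  have FM: "(\<lambda>(p, x). F p x) \<in> borel_measurable (lborel \<Otimes>\<^sub>M lborel)"
    unfolding F_def case_prod_beta measurable_cong_sets[OF sets_eq refl]
    by (intro borel_measurable_times fM wM uM EM continuous_intros)
  have prod: "integrable (lborel \<Otimes>\<^sub>M lborel) (\<lambda>(p, x). norm (f p) * norm (w x) * B)"
  proof (rule lborel_pair.Fubini_integrable)
    show "(\<lambda>(p, x). norm (f p) * norm (w x) * B) \<in> borel_measurable (lborel \<Otimes>\<^sub>M lborel)"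
      by measurable
    show "integrable lborel (\<lambda>p. LINT x|lborel. norm (case (p, x) of (p, x) \<Rightarrow> norm (f p) * norm (w x) * B))"
      using f B0 by (simp add: abs_mult)
    show "AE p in lborel. integrable lborel (\<lambda>x. case (p, x) of (p, x) \<Rightarrow> norm (f p) * norm (w x) * B)"
      using w by simp
  qed
  have FI: "integrable (lborel \<Otimes>\<^sub>M lborel) (\<lambda>(p, x). F p x)"
  proof (rule Bochner_Integration.integrable_bound[OF prod FM], intro AE_I2, clarify)
    fix p :: "real \<times> real" and x
    have "norm (F p x) = norm (f p) * norm (w x) * norm (u (2 * fst p - x))"
      unfolding F_def by (simp add: norm_mult E1)
    also have "\<dots> \<le> norm (f p) * norm (w x) * B" by (intro mult_left_mono B) auto
    finally show "norm (F p x) \<le> norm (norm (f p) * norm (w x) * B)"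
      by (metis abs_ge_self order_trans real_norm_def)
  qed
  have inner: "(LINT t|lborel. w (fst p + t) * u (fst p - t) * exp (2 * \<i> * of_real (pi * t * snd p)))
      = (LINT x|lborel. w x * u (2 * fst p - x) * E (2 * pi * (x - fst p) * snd p))" for p :: "real \<times> real"
    by (subst lborel_integral_real_affine[where c = 1 and t = "fst p"])
       (auto simp: E_def algebra_simps intro!: Bochner_Integration.integral_cong)
  have "sesq v (Psi (\<lambda>h. LINT p|lborel. f p * h p) u) = (LINT p|lborel. f p *
      (LINT t|lborel. w (fst p + t) * u (fst p - t) * exp (2 * \<i> * of_real (pi * t * snd p))))"
    by (simp add: sesq_def Psi_def w_def case_prod_beta)
  also have "\<dots> = (LINT p|lborel. LINT x|lborel. F p x)"
    by (simp only: inner) (simp add: F_def)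
  also have "\<dots> = (LINT x|lborel. LINT p|lborel. F p x)"
    using lborel_pair.Fubini_integral[OF FI] by simp
  also have "\<dots> = (LINT x|lborel. w x * (1 / 2 * (LINT p|lborel.
          f ((x + fst p) / 2, snd p) * exp (\<i> * of_real (pi * (x - fst p) * snd p)) * u (fst p))))"
  proof (intro Bochner_Integration.integral_cong refl)
    fix x :: real
    define c where "c = (\<lambda>j::real \<times> real. if j = (1, 0) then 1 / 2 else 1 :: real)"
    define T where "T = (\<lambda>p. (x / 2, 0) + (\<Sum>j\<in>Basis. (c j * (p \<bullet> j)) *\<^sub>R (j :: real \<times> real)))"
    have T: "T p = ((x + fst p) / 2, snd p)" for p
      by (cases p) (auto simp: T_def c_def Basis_prod_def sum.union_disjoint sum.reindex inj_on_def field_simps)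
    have [measurable]: "T \<in> borel_measurable borel"
      unfolding T[abs_def] by (intro borel_measurable_continuous_onI continuous_intros) auto
    have c: "(\<Prod>j\<in>Basis. \<bar>c j\<bar>) = 1 / 2"
      by (auto simp: c_def Basis_prod_def prod.union_disjoint prod.reindex inj_on_def)
    have "lborel = density (distr lborel borel T) (\<lambda>_. (\<Prod>j\<in>Basis. \<bar>c j\<bar>))"
      unfolding T_def by (rule lborel_affine_euclidean) (auto simp: c_def)
    hence L: "lborel = density (distr lborel borel T) (\<lambda>_. ennreal (1 / 2))" unfolding c .
    have [measurable]: "(\<lambda>p. F p x) \<in> borel_measurable borel"
      unfolding F_def by (intro borel_measurable_times uM EM continuous_intros) auto
    have "(LINT p|lborel. F p x) = (LINT p|density (distr lborel borel T) (\<lambda>_. ennreal (1 / 2)). F p x)"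
      using L by simp
    also have "\<dots> = 1 / 2 * (LINT p|lborel. F (T p) x)"
      by (subst integral_density) (auto simp: integral_distr scaleR_conv_of_real)
    also have "(LINT p|lborel. F (T p) x) = (LINT p|lborel. w x * (
          f ((x + fst p) / 2, snd p) * exp (\<i> * of_real (pi * (x - fst p) * snd p)) * u (fst p)))"
    proof (intro Bochner_Integration.integral_cong refl)
      fix p :: "real \<times> real"
      have "2 * ((x + fst p) / 2) - x = fst p"
        and "2 * pi * (x - (x + fst p) / 2) * snd p = pi * (x - fst p) * snd p"
        by (simp_all add: field_simps)
      thus "F (T p) x = w x * (
          f ((x + fst p) / 2, snd p) * exp (\<i> * of_real (pi * (x - fst p) * snd p)) * u (fst p))"
        unfolding T F_def E_def fst_conv snd_conv by (simp only: mult_ac)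
    qed
    finally show "(LINT p|lborel. F p x) = w x * (1 / 2 * (LINT p|lborel.
          f ((x + fst p) / 2, snd p) * exp (\<i> * of_real (pi * (x - fst p) * snd p)) * u (fst p)))"
      by simp
  qed
  finally show ?thesis unfolding w_def case_prod_unfold .
qed

end

theory Submission
  imports Defs
begin

text \<open>For squarefree \<open>N\<close> one has \<open>a(gcd(j, k, N)) = \<Sum> \<mu>(d) d\<close> over the \<open>d | N\<close> dividing both \<open>j\<close> and
  \<open>k\<close>, so the pairing is a combination of sums over the sublattices \<open>d\<int> \<times> d\<int>\<close>, rescaled by \<open>1/Q\<close>.
  Poisson summation in the second variable undoes the Fourier transform and turns such a sum into
  \<open>Q/d\<close> times the sum of \<open>cnj v(x) u(y)\<close> over the points \<open>x = n d/Q + l Q/d\<close>, \<open>y = n d/Q - l Q/d\<close>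
  with \<open>n, l\<close> integers. Since \<open>x\<^sup>2 - y\<^sup>2 = 4 n l\<close>, the support condition only lets \<open>n = l = 1\<close>
  survive. Writing \<open>d = Q\<^sub>1 R\<^sub>1\<close> gives the formula. The support condition also makes \<open>v\<close> and \<open>u\<close>
  compactly supported unless one of them vanishes identically, so Poisson summation is only needed
  for compactly supported functions, and only finitely many rows \<open>j\<close> contribute.\<close>

section \<open>Poisson summation\<close>

lemma has_vector_derivative_cis:
  "((\<lambda>s. cis (w * s)) has_vector_derivative \<i> * of_real w * cis (w * s)) (at s within A)"
proof -
  have "((\<lambda>z. exp (\<i> * of_real w * z)) has_field_derivative \<i> * of_real w * exp (\<i> * of_real w * of_real s))
      (at (of_real s))"
    by (auto intro!: derivative_eq_intros)
  from has_vector_derivative_real_field[OF this] show ?thesis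
    by (simp add: cis_conv_exp mult.assoc has_vector_derivative_at_within)
qed

text \<open>Fundamental theorem of calculus for \<open>f s * cis (w * s)\<close>, solved for the
  term containing \<open>f\<close>. Each use gains a factor \<open>1 / w\<close>.\<close>

lemma integral_cis_by_parts:
  fixes f :: "real \<Rightarrow> complex"
  assumes "a \<le> b" "w \<noteq> 0"
    and "\<And>s. s \<in> {a..b} \<Longrightarrow> (f has_vector_derivative f' s) (at s)"
    and "continuous_on {a..b} f'"
  shows "integral {a..b} (\<lambda>s. f s * cis (w * s)) =
    (f b * cis (w * b) - f a * cis (w * a) - integral {a..b} (\<lambda>s. f' s * cis (w * s))) / (\<i> * of_real w)"
proof -
  let ?c = "\<i> * of_real w :: complex"
  have "((\<lambda>s. f' s * cis (w * s) + ?c * (f s * cis (w * s))) has_integral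
      (f b * cis (w * b) - f a * cis (w * a))) {a..b}"
  proof (rule fundamental_theorem_of_calculus[OF assms(1)])
    fix s assume s: "s \<in> {a..b}"
    show "((\<lambda>s. f s * cis (w * s)) has_vector_derivative f' s * cis (w * s) + ?c * (f s * cis (w * s)))
        (at s within {a..b})"
      by (rule has_vector_derivative_eq_rhs[OF has_vector_derivative_mult
            [OF has_vector_derivative_at_within[OF assms(3)[OF s]] has_vector_derivative_cis]])
         (simp add: algebra_simps)
  qed
  moreover have i1: "(\<lambda>s. f' s * cis (w * s)) integrable_on {a..b}"
    by (intro integrable_continuous_interval continuous_intros assms)
  ultimately have "((\<lambda>s. ?c * (f s * cis (w * s))) has_integral
      (f b * cis (w * b) - f a * cis (w * a) - integral {a..b} (\<lambda>s. f' s * cis (w * s)))) {a..b}"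
    using has_integral_diff[OF _ integrable_integral[OF i1]] by fastforce
  from has_integral_mult_right[OF this, of "inverse ?c"] show ?thesis
    using assms(2) by (simp add: integral_unique field_simps)
qed

lemma norm_integral_cis_le:
  fixes f :: "real \<Rightarrow> complex"
  assumes "a \<le> b" "continuous_on {a..b} f" "\<And>s. s \<in> {a..b} \<Longrightarrow> norm (f s) \<le> B"
  shows "norm (integral {a..b} (\<lambda>s. f s * cis (w * s))) \<le> B * (b - a)"
  by (rule integral_bound) (use assms in \<open>auto simp: norm_mult intro!: continuous_intros\<close>)

text \<open>A continuous \<open>f\<close> may have no derivative to integrate by parts with, so it
  is replaced by a uniformly close polynomial \<open>p\<close>. The integral of \<open>p\<close> is
  O(1/|w|) by parts, and the error from \<open>f - p\<close> is small uniformly in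
  \<open>w\<close>.\<close>

lemma Riemann_Lebesgue:
  fixes f :: "real \<Rightarrow> complex"
  assumes "a \<le> b" "continuous_on {a..b} f"
  shows "((\<lambda>w. integral {a..b} (\<lambda>s. f s * cis (w * s))) \<longlongrightarrow> 0) at_infinity"
proof (rule tendstoI)
  fix e :: real assume e: "e > 0"
  \<comment> \<open>The summand 1 keeps the denominator positive when \<open>a = b\<close> and makes
    \<open>d * (b - a) < e / 2\<close> strict.\<close>
  define d where "d = e / (2 * (b - a + 1))"
  have d: "d > 0" "d * (b - a) < e / 2"
    using e assms(1) by (auto simp: d_def field_simps)
  obtain p where p: "polynomial_function p" "\<And>s. s \<in> {a..b} \<Longrightarrow> norm (f s - p s) < d"
    using Stone_Weierstrass_polynomial_function[OF compact_Icc assms(2) d(1)] by auto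
  obtain p' where p': "polynomial_function p'" "\<And>s. (p has_vector_derivative p' s) (at s)"
    using has_vector_derivative_polynomial_function[OF p(1)] by blast
  have cp: "continuous_on {a..b} p" "continuous_on {a..b} p'"
    using p(1) p'(1) continuous_on_polymonial_function by auto
  have "bounded (p' ` {a..b})"
    using compact_continuous_image[OF cp(2)] compact_imp_bounded by blast
  then obtain K where K: "\<And>s. s \<in> {a..b} \<Longrightarrow> norm (p' s) \<le> K"
    by (auto simp only: bounded_iff ball_simps)
  define C where "C = norm (p b) + norm (p a) + K * (b - a)"
  have "norm (p' a) \<le> K" using K assms(1) by simp
  hence "0 \<le> K" using norm_ge_zero order_trans by blast
  hence C: "C \<ge> 0" using assms(1) by (simp add: C_def)
  show "\<forall>\<^sub>F w in at_infinity. dist (integral {a..b} (\<lambda>s. f s * cis (w * s))) 0 < e"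
    unfolding eventually_at_infinity
  \<comment> \<open>Beyond this threshold \<open>C / \<bar>w\<bar> < e / 2\<close>; taking
    \<open>C + 1\<close> rather than \<open>C\<close> also forces \<open>w \<noteq> 0\<close> when
    \<open>C = 0\<close>.\<close>
  proof (intro exI[of _ "2 * (C + 1) / e"] allI impI)
    fix w :: real assume w: "2 * (C + 1) / e \<le> norm w"
    hence w0: "w \<noteq> 0" using C e by (auto simp: field_simps)
    have "norm (p b * cis (w * b) - p a * cis (w * a) - integral {a..b} (\<lambda>s. p' s * cis (w * s))) \<le> C"
      unfolding C_def
      by (intro norm_triangle_le_diff add_mono norm_integral_cis_le assms cp K)
         (auto simp: norm_mult)
    hence "norm (integral {a..b} (\<lambda>s. p s * cis (w * s))) \<le> C / \<bar>w\<bar>"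
      by (subst integral_cis_by_parts[OF assms(1) w0 p'(2) cp(2)])
         (auto simp: norm_divide norm_mult divide_right_mono)
    also have "\<dots> < e / 2"
      using w w0 C e by (simp add: field_simps)
    finally have 1: "norm (integral {a..b} (\<lambda>s. p s * cis (w * s))) < e / 2" .
    have "norm (integral {a..b} (\<lambda>s. (f s - p s) * cis (w * s))) \<le> d * (b - a)"
      by (rule norm_integral_cis_le) (use assms cp p(2) in \<open>auto intro!: continuous_intros less_imp_le\<close>)
    also have "\<dots> < e / 2" by (rule d)
    finally have 2: "norm (integral {a..b} (\<lambda>s. (f s - p s) * cis (w * s))) < e / 2" .
    have "integral {a..b} (\<lambda>s. f s * cis (w * s)) =
        integral {a..b} (\<lambda>s. (f s - p s) * cis (w * s)) + integral {a..b} (\<lambda>s. p s * cis (w * s))"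
      by (subst integral_add[symmetric])
         (use assms cp in \<open>auto intro!: integrable_continuous_interval continuous_intros simp: algebra_simps\<close>)
    thus "dist (integral {a..b} (\<lambda>s. f s * cis (w * s))) 0 < e"
      using 1 2 norm_triangle_ineq[of "integral {a..b} (\<lambda>s. (f s - p s) * cis (w * s))"
        "integral {a..b} (\<lambda>s. p s * cis (w * s))"] by (simp add: add.commute)
  qed
qed

section \<open>Convergence of symmetric Fourier sums at the integers\<close>

lemma cis_2pi_int: "cis (2 * pi * of_int m * of_int l) = 1"
proof -
  have "2 * pi * of_int m * of_int l = 2 * pi * of_int (m * l)" by simp
  thus ?thesis by (simp only: cis_multiple_2pi Ints_of_int)
qed

lemma sum_symmetric_int_Suc:
  fixes f :: "int \<Rightarrow> 'a::comm_monoid_add"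
  shows "(\<Sum>m=-int (Suc M)..int (Suc M). f m) =
     (\<Sum>m=-int M..int M. f m) + f (int (Suc M)) + f (- int (Suc M))"
proof -
  have "{-int (Suc M)..int (Suc M)} = insert (-int (Suc M)) (insert (int (Suc M)) {-int M..int M})"
    by auto
  thus ?thesis by (simp add: add_ac)
qed

lemma sum_symmetric_int_telescope:
  fixes G :: "int \<Rightarrow> 'a::ab_group_add"
  shows "(\<Sum>m=-int M..int M. G (m + 1) - G m) = G (int M + 1) - G (- int M)"
proof (induction M)
  case (Suc M)
  have "- int (Suc M) + 1 = - int M" "int M + 1 = int (Suc M)" by simp_all
  thus ?case unfolding sum_symmetric_int_Suc Suc by (simp add: add.commute)
qed simp

text \<open>These are the Fourier coefficients of a linear interpolant between consecutive integers.
  For \<open>m \<noteq> 0\<close> the exponential is 1 at both ends and integrates to 0, so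
  integration by parts leaves only the jump \<open>B\<close> of the boundary values.\<close>

lemma integral_linear_cis:
  fixes A B :: complex and l m :: int
  shows "integral {of_int l..of_int l + 1} (\<lambda>s. (A + of_real (s - of_int l) * B) * cis (2 * pi * of_int m * s)) =
    (if m = 0 then A + B / 2 else B / (2 * \<i> * pi * of_int m))"
proof (cases "m = 0")
  case True
  let ?F = "\<lambda>s::real. A * of_real s + of_real ((s - of_int l)\<^sup>2 / 2) * B"
  have "(?F has_vector_derivative A + of_real (s - of_int l) * B) (at s within X)" for s X
  proof -
    have "((\<lambda>z. A * z + (z - of_int l)\<^sup>2 / 2 * B) has_field_derivative A + (of_real s - of_int l) * B)
        (at (of_real s))"
      by (auto intro!: derivative_eq_intros)
    from has_vector_derivative_real_field[OF this] show ?thesis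
      by (simp add: has_vector_derivative_at_within)
  qed
  hence "((\<lambda>s. A + of_real (s - of_int l) * B) has_integral ?F (of_int l + 1) - ?F (of_int l))
      {of_int l..of_int l + 1}"
    by (intro fundamental_theorem_of_calculus) auto
  thus ?thesis using True by (simp add: integral_unique algebra_simps)
next
  case False
  define w where "w = 2 * pi * of_int m"
  have e: "cis (w * (of_int l + 1)) = 1" "cis (w * of_int l) = 1"
    using cis_2pi_int[of m "l + 1"] cis_2pi_int[of m l] by (auto simp: w_def)
  have w: "w \<noteq> 0" using False by (simp add: w_def)
  have 1: "integral {of_int l..of_int l + 1} (\<lambda>s. B * cis (w * s)) = 0"
    by (subst integral_cis_by_parts[OF _ w, where f' = "\<lambda>_. 0"]) (auto simp: e)
  have 2: "((\<lambda>s. A + of_real (s - of_int l) * B) has_vector_derivative B) (at s)" for s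
  proof -
    have "((\<lambda>z. A + (z - of_int l) * B) has_field_derivative B) (at (of_real s))"
      by (auto intro!: derivative_eq_intros)
    from has_vector_derivative_real_field[OF this] show ?thesis by simp
  qed
  have "integral {of_int l..of_int l + 1} (\<lambda>s. (A + of_real (s - of_int l) * B) * cis (w * s)) =
      B / (\<i> * of_real w)"
    by (subst integral_cis_by_parts[OF _ w 2]) (simp_all only: e 1, simp_all)
  thus ?thesis using False by (simp add: w_def mult_ac)
qed

text \<open>The terms at \<open>m\<close> and \<open>- m\<close> cancel. Hence the interpolant
  contributes exactly its mean \<open>A + B / 2\<close> to every symmetric partial sum.\<close>

lemma sum_symmetric_int_odd:
  fixes B c :: complex
  shows "(\<Sum>m=-int M..int M. if m = 0 then c else B / (2 * \<i> * pi * of_int m)) = c"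
proof (induction M)
  case (Suc M)
  have "B / (2 * \<i> * pi * of_int (- int (Suc M))) = - (B / (2 * \<i> * pi * of_int (int (Suc M))))"
    by (metis minus_divide_right mult_minus_right of_int_minus)
  thus ?case unfolding sum_symmetric_int_Suc Suc by simp
qed simp

text \<open>L'Hopital's rule at a common zero: dividing \<open>h\<close> and \<open>k\<close> by
  \<open>s - a\<close> turns both into difference quotients. It supplies the continuity of
  \<open>H\<close> at the endpoints below.\<close>

lemma has_vector_derivative_divide_tendsto:
  fixes h k :: "real \<Rightarrow> complex"
  assumes "(h has_vector_derivative h') (at a)" "(k has_vector_derivative k') (at a)"
    and "h a = 0" "k a = 0" "k' \<noteq> 0"
  shows "((\<lambda>s. h s / k s) \<longlongrightarrow> h' / k') (at a)"
proof -
  have slope: "((\<lambda>s. f s / of_real (s - a)) \<longlongrightarrow> D) (at a)"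
    if "(f has_vector_derivative D) (at a)" "f a = 0" for f :: "real \<Rightarrow> complex" and D
  proof -
    have "((\<lambda>s. norm (f s - f a - (s - a) *\<^sub>R D) / norm (s - a)) \<longlongrightarrow> 0) (at a)"
      using that(1) by (simp add: has_vector_derivative_def has_derivative_iff_norm)
    moreover have "\<forall>\<^sub>F s in at a. norm (f s - f a - (s - a) *\<^sub>R D) / norm (s - a) =
        norm (f s / of_real (s - a) - D)"
      unfolding eventually_at_filter
    proof (intro always_eventually allI impI)
      fix s assume "s \<noteq> a"
      hence "f s / of_real (s - a) - D = (f s - f a - (s - a) *\<^sub>R D) / of_real (s - a)"
        using that(2) by (simp add: field_simps scaleR_conv_of_real)
      thus "norm (f s - f a - (s - a) *\<^sub>R D) / norm (s - a) = norm (f s / of_real (s - a) - D)"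
        by (simp only: norm_divide norm_of_real real_norm_def)
    qed
    ultimately have "((\<lambda>s. norm (f s / of_real (s - a) - D)) \<longlongrightarrow> 0) (at a)"
      by (rule Lim_transform_eventually)
    thus ?thesis by (simp only: tendsto_norm_zero_iff LIM_zero_iff)
  qed
  have "((\<lambda>s. (h s / of_real (s - a)) / (k s / of_real (s - a))) \<longlongrightarrow> h' / k') (at a)"
    by (intro tendsto_divide slope assms)
  thus ?thesis
    by (rule Lim_transform_eventually) (auto simp: eventually_at_filter)
qed

lemma cis_eq_1_imp_int:
  assumes "cis (2 * pi * s) = 1" "of_int l \<le> s" "s \<le> of_int l + 1"
  shows "s = of_int l \<or> s = of_int l + 1"
proof -
  have "cos (2 * pi * s) = 1" using assms(1) by (simp add: complex_eq_iff)
  then obtain n :: int where "2 * pi * s = n * 2 * pi" by (auto simp: cos_one_2pi_int)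
  hence "s = of_int n" by simp
  moreover from this have "l \<le> n" "n \<le> l + 1" using assms(2,3) by linarith+
  hence "n = l \<or> n = l + 1" by linarith
  ultimately show ?thesis by auto
qed

text \<open>Subtracting the linear interpolant leaves a function \<open>h\<close> vanishing at both endpoints, hence
  \<open>h(s) = H(s) (cis(2\<pi>s) - 1)\<close> with \<open>H\<close> continuous. The symmetric partial sums of the Fourier
  coefficients of \<open>h\<close> then telescope to two coefficients of \<open>H\<close>, which vanish in the limit by the
  Riemann--Lebesgue lemma.\<close>

lemma fourier_sum_unit_interval:
  fixes g :: "real \<Rightarrow> complex" and l :: int
  assumes g: "\<And>s. (g has_vector_derivative g' s) (at s)"
  shows "(\<lambda>M. \<Sum>m=-int M..int M. integral {of_int l..of_int l + 1} (\<lambda>s. g s * cis (2 * pi * of_int m * s)))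
     \<longlonglongrightarrow> (g (of_int l) + g (of_int l + 1)) / 2"
proof -
  let ?I = "{of_int l..of_int l + 1 :: real}"
  define A B where "A = g (of_int l)" and "B = g (of_int l + 1) - g (of_int l)"
  define h where "h = (\<lambda>s. g s - (A + of_real (s - of_int l) * B))"
  define k where "k = (\<lambda>s. cis (2 * pi * s) - 1)"
  have dl: "((\<lambda>s::real. A + of_real (s - of_int l) * B) has_vector_derivative B) (at s)" for s
  proof -
    have "((\<lambda>z. A + (z - of_int l) * B) has_field_derivative B) (at (of_real s))"
      by (auto intro!: derivative_eq_intros)
    from has_vector_derivative_real_field[OF this] show ?thesis by simp
  qed
  have dh: "(h has_vector_derivative g' s - B) (at s)" for s
    unfolding h_def by (intro has_vector_derivative_diff g dl)
  have dk: "(k has_vector_derivative \<i> * of_real (2 * pi) * cis (2 * pi * s)) (at s)" for s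
    unfolding k_def
    using has_vector_derivative_diff[OF has_vector_derivative_cis[of "2 * pi" s] has_vector_derivative_const[of 1]]
    by simp
  have cg: "continuous_on X g" for X
    by (rule continuous_on_vector_derivative[OF has_vector_derivative_at_within[OF g]])
  have ch: "continuous_on X h" and ck: "continuous_on X k" for X
    by (rule continuous_on_vector_derivative[OF has_vector_derivative_at_within], rule dh dk)+
  have h0: "h (of_int l) = 0" "h (of_int l + 1) = 0" by (auto simp: h_def A_def B_def)
  have e: "cis (2 * pi * of_int l) = 1" "cis (2 * pi * (of_int l + 1)) = 1"
    using cis_2pi_int[of 1 l] cis_2pi_int[of 1 "l + 1"] by auto
  have k0: "k s = 0 \<longleftrightarrow> s = of_int l \<or> s = of_int l + 1" if "s \<in> ?I" for s
    using that cis_eq_1_imp_int[of s l] e by (auto simp: k_def)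
  \<comment> \<open>\<open>k\<close> vanishes on the interval only at the endpoints, where its
    derivative is \<open>2 * pi * \<i>\<close>; the values there are the limits of
    \<open>h s / k s\<close>.\<close>
  define H where "H = (\<lambda>s. if s = of_int l \<or> s = of_int l + 1 then (g' s - B) / (2 * pi * \<i>) else h s / k s)"
  have lim: "((\<lambda>s. h s / k s) \<longlongrightarrow> (g' s - B) / (2 * pi * \<i>)) (at s)" if "s = of_int l \<or> s = of_int l + 1" for s
    by (rule has_vector_derivative_divide_tendsto[OF dh]) (use dk[of s] that e h0 in \<open>auto simp: k_def mult_ac\<close>)
  have cH: "continuous_on ?I H"
    unfolding continuous_on_def
  proof
    fix s assume s: "s \<in> ?I"
    \<comment> \<open>Close to \<open>s\<close>, but different from \<open>s\<close>, there is no
      endpoint, so the second branch of \<open>H\<close> applies.\<close>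
    have ev: "\<forall>\<^sub>F x in at s within ?I. h x / k x = H x"
    proof -
      have "open (- ({of_int l, of_int l + 1} - {s}))" by (intro open_Compl finite_imp_closed) auto
      hence "\<forall>\<^sub>F x in at s. x \<in> - ({of_int l, of_int l + 1} - {s})"
        by (rule eventually_at_in_open') auto
      moreover have "\<forall>\<^sub>F x in at s. x \<noteq> s" by (simp add: eventually_at_filter)
      ultimately have "\<forall>\<^sub>F x in at s. h x / k x = H x"
        by eventually_elim (auto simp: H_def)
      thus ?thesis using at_le[of ?I UNIV s] filter_leD by blast
    qed
    have "((\<lambda>s. h s / k s) \<longlongrightarrow> H s) (at s within ?I)"
    proof (cases "s = of_int l \<or> s = of_int l + 1")
      case True
      thus ?thesis using lim[OF True] by (auto simp: H_def intro: tendsto_within_subset)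
    next
      case False
      hence "k s \<noteq> 0" using k0[OF s] by simp
      moreover have "(h \<longlongrightarrow> h s) (at s within ?I)" "(k \<longlongrightarrow> k s) (at s within ?I)"
        using ch[of ?I] ck[of ?I] s by (auto simp: continuous_on_def)
      ultimately show ?thesis using False by (auto simp: H_def intro!: tendsto_divide)
    qed
    thus "(H \<longlongrightarrow> H s) (at s within ?I)" using ev by (rule Lim_transform_eventually)
  qed
  define G where "G = (\<lambda>m::int. integral ?I (\<lambda>s. H s * cis (2 * pi * of_int m * s)))"
  have int_h: "integral ?I (\<lambda>s. h s * cis (2 * pi * of_int m * s)) = G (m + 1) - G m" for m
  proof -
    have "h s * cis (2 * pi * of_int m * s) =
        H s * cis (2 * pi * of_int (m + 1) * s) - H s * cis (2 * pi * of_int m * s)" if "s \<in> ?I" for s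
    proof -
      have "h s = H s * k s" using k0[OF that] h0 by (auto simp: H_def)
      moreover have "cis (2 * pi * of_int (m + 1) * s) = cis (2 * pi * s) * cis (2 * pi * of_int m * s)"
        by (simp add: cis_mult algebra_simps)
      ultimately show ?thesis
        by (simp only: k_def left_diff_distrib right_diff_distrib mult.assoc mult_1_right)
    qed
    hence "integral ?I (\<lambda>s. h s * cis (2 * pi * of_int m * s)) =
      integral ?I (\<lambda>s. H s * cis (2 * pi * of_int (m + 1) * s) - H s * cis (2 * pi * of_int m * s))"
      by (intro integral_cong) auto
    also have "\<dots> = G (m + 1) - G m" unfolding G_def
      by (intro integral_diff integrable_continuous_interval continuous_intros cH)
    finally show ?thesis .
  qed
  have int_g: "integral ?I (\<lambda>s. g s * cis (2 * pi * of_int m * s)) =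
      (G (m + 1) - G m) + (if m = 0 then A + B / 2 else B / (2 * \<i> * pi * of_int m))" for m
    unfolding int_h[symmetric] integral_linear_cis[of l A B m, symmetric]
    by (subst integral_add[symmetric])
       (auto intro!: integrable_continuous_interval continuous_intros ch cg simp: h_def algebra_simps)
  have sum_g: "(\<Sum>m=-int M..int M. integral ?I (\<lambda>s. g s * cis (2 * pi * of_int m * s))) =
      G (int M + 1) - G (- int M) + (A + B / 2)" for M
    by (simp only: int_g sum.distrib sum_symmetric_int_telescope sum_symmetric_int_odd)
  have G0: "(\<lambda>M. G (q M)) \<longlonglongrightarrow> 0" if "filterlim (\<lambda>M. 2 * pi * of_int (q M)) at_infinity sequentially"
    for q :: "nat \<Rightarrow> int"
    unfolding G_def using filterlim_compose[OF Riemann_Lebesgue[OF _ cH] that] by simp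
  have top: "filterlim (\<lambda>M. 2 * pi * real M) at_top sequentially"
    by (intro filterlim_tendsto_pos_mult_at_top[OF tendsto_const] filterlim_real_sequentially) simp
  \<comment> \<open>The two surviving frequencies run to plus and minus infinity;
    \<open>at_infinity\<close> covers both directions.\<close>
  have "filterlim (\<lambda>M. 2 * pi * of_int (int M + 1)) at_infinity sequentially"
    by (rule filterlim_at_top_imp_at_infinity, rule filterlim_at_top_mono[OF top]) auto
  moreover have "filterlim (\<lambda>M. 2 * pi * of_int (- int M)) at_infinity sequentially"
    by (rule filterlim_norm_at_top_imp_at_infinity) (use top in \<open>simp add: abs_mult\<close>)
  ultimately have "(\<lambda>M. G (int M + 1) - G (- int M) + (A + B / 2)) \<longlonglongrightarrow> 0 - 0 + (A + B / 2)"
    by (intro tendsto_intros G0)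
  also have "0 - 0 + (A + B / 2) = (g (of_int l) + g (of_int l + 1)) / 2"
    by (simp add: A_def B_def field_simps)
  finally show ?thesis unfolding sum_g .
qed

text \<open>Unit intervals are added on both sides. An interior integer receives half its value from
  each neighbouring interval, while the two endpoints receive only one half, which explains the
  correction term. For \<open>L = 0\<close> both sides are 0.\<close>

lemma fourier_sum_symmetric_interval:
  fixes g :: "real \<Rightarrow> complex" and L :: nat
  assumes g: "\<And>s. (g has_vector_derivative g' s) (at s)"
  shows "(\<lambda>M. \<Sum>m=-int M..int M. integral {-real L..real L} (\<lambda>s. g s * cis (2 * pi * of_int m * s)))
     \<longlonglongrightarrow> (\<Sum>l=-int L..int L. g (of_int l)) - (g (real L) + g (- real L)) / 2"
proof (induction L)
  case (Suc L)
  have cg: "continuous_on X g" for X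
    by (rule continuous_on_vector_derivative[OF has_vector_derivative_at_within[OF g]])
  have split: "integral {-real (Suc L)..real (Suc L)} f =
      integral {of_int (-int (Suc L))..of_int (-int (Suc L)) + 1} f + integral {-real L..real L} f +
      integral {of_int (int L)..of_int (int L) + 1} f"
    if "\<And>X. continuous_on X f" for f :: "real \<Rightarrow> complex"
  proof -
    have i: "f integrable_on {a..b}" for a b by (intro integrable_continuous_interval that)
    have "integral {-real (Suc L)..real (Suc L)} f =
        integral {-real (Suc L)..-real L} f + integral {-real L..real (Suc L)} f"
      by (rule Henstock_Kurzweil_Integration.integral_combine[symmetric]) (auto intro: i)
    also have "integral {-real L..real (Suc L)} f = integral {-real L..real L} f + integral {real L..real (Suc L)} f"
      by (rule Henstock_Kurzweil_Integration.integral_combine[symmetric]) (auto intro: i)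
    finally show ?thesis by (simp add: add_ac)
  qed
  have "(\<lambda>M. (\<Sum>m=-int M..int M. integral {of_int (-int (Suc L))..of_int (-int (Suc L)) + 1} (\<lambda>s. g s * cis (2 * pi * of_int m * s)))
      + (\<Sum>m=-int M..int M. integral {-real L..real L} (\<lambda>s. g s * cis (2 * pi * of_int m * s)))
      + (\<Sum>m=-int M..int M. integral {of_int (int L)..of_int (int L) + 1} (\<lambda>s. g s * cis (2 * pi * of_int m * s))))
    \<longlonglongrightarrow> (g (of_int (-int (Suc L))) + g (of_int (-int (Suc L)) + 1)) / 2
      + ((\<Sum>l=-int L..int L. g (of_int l)) - (g (real L) + g (- real L)) / 2)
      + (g (of_int (int L)) + g (of_int (int L) + 1)) / 2" (is "_ \<longlonglongrightarrow> ?R")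
    by (intro tendsto_add fourier_sum_unit_interval[OF g] Suc)
  also have "?R = (\<Sum>l=-int (Suc L)..int (Suc L). g (of_int l)) - (g (real (Suc L)) + g (- real (Suc L))) / 2"
    unfolding sum_symmetric_int_Suc by (simp add: field_simps)
  finally show ?case
    by (subst split) (auto simp: sum.distrib intro!: continuous_intros cg)
qed simp

section \<open>Unconditional convergence and the Poisson formula\<close>

lemma summable_on_int_inverse_square: "(\<lambda>m::int. inverse ((of_int m)\<^sup>2) :: real) summable_on UNIV"
proof -
  let ?f = "\<lambda>m::int. inverse ((of_int m)\<^sup>2) :: real"
  have n: "(\<lambda>n::nat. inverse ((real n)\<^sup>2)) summable_on UNIV"
    using inverse_power_summable[of 2, where 'a = real]
    by (subst summable_on_UNIV_nonneg_real_iff) auto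
  have "?f summable_on (range int)"
    by (subst summable_on_reindex) (use n in \<open>auto simp: o_def\<close>)
  moreover have "?f summable_on ((\<lambda>n. - int n) ` {1..})"
    by (subst summable_on_reindex)
       (use summable_on_subset_banach[OF n, of "{1..}"] in \<open>auto simp: o_def inj_on_def\<close>)
  moreover have "range int \<inter> (\<lambda>n. - int n) ` {1..} = {}" by auto
  ultimately have "?f summable_on (range int \<union> (\<lambda>n. - int n) ` {1..})"
    by (rule summable_on_Un_disjoint)
  also have "range int \<union> (\<lambda>n. - int n) ` {1..} = UNIV"
  proof -
    have "m \<in> range int \<union> (\<lambda>n. - int n) ` {1..}" for m
      by (cases m rule: int_cases) (auto intro!: image_eqI[of _ _ "Suc _"])
    thus ?thesis by auto
  qed
  finally show ?thesis .
qed

text \<open>Two integrations by parts without boundary terms give decay of order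
  \<open>1 / m^2\<close>. This provides the unconditional summability that \<open>has_sum\<close>
  demands and that convergence of symmetric partial sums does not give.\<close>

lemma fourier_integral_summable:
  fixes g :: "real \<Rightarrow> complex" and L :: nat
  assumes g: "\<And>s. (g has_vector_derivative g' s) (at s)"
    and g': "\<And>s. (g' has_vector_derivative g'' s) (at s)"
    and g'': "continuous_on UNIV g''"
    and zero: "g (real L) = 0" "g (- real L) = 0" "g' (real L) = 0" "g' (- real L) = 0"
  shows "(\<lambda>m::int. integral {-real L..real L} (\<lambda>s. g s * cis (2 * pi * of_int m * s))) summable_on UNIV"
proof -
  let ?I = "{-real L..real L}"
  have cg': "continuous_on X g'" for X
    by (rule continuous_on_vector_derivative[OF has_vector_derivative_at_within[OF g']])
  have cg'': "continuous_on X g''" for X using continuous_on_subset[OF g''] by auto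
  have "bounded (g'' ` ?I)"
    using compact_continuous_image[OF cg'' compact_Icc] compact_imp_bounded by blast
  then obtain K where K: "\<And>s. s \<in> ?I \<Longrightarrow> norm (g'' s) \<le> K"
    by (auto simp only: bounded_iff ball_simps)
  define C where "C = norm (integral ?I (\<lambda>s. g s * cis (2 * pi * of_int 0 * s)))"
  \<comment> \<open>Since \<open>inverse 0 = 0\<close>, the bound at \<open>m = 0\<close> is just
    \<open>C\<close>.\<close>
  let ?b = "\<lambda>m::int. (if m = 0 then C else 0) + K * (2 * real L) / (2 * pi)\<^sup>2 * inverse ((of_int m)\<^sup>2)"
  have bound: "norm (integral ?I (\<lambda>s. g s * cis (2 * pi * of_int m * s))) \<le> ?b m" for m :: int
  proof (cases "m = 0")
    case False
    define w where "w = 2 * pi * of_int m"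
    have w: "w \<noteq> 0" using False by (simp add: w_def)
    have "integral ?I (\<lambda>s. g s * cis (w * s)) =
        integral ?I (\<lambda>s. g'' s * cis (w * s)) / (\<i> * of_real w)\<^sup>2"
      by (subst integral_cis_by_parts[OF _ w g cg'], simp,
          subst integral_cis_by_parts[OF _ w g' cg''])
         (simp_all add: zero power2_eq_square)
    hence "norm (integral ?I (\<lambda>s. g s * cis (w * s))) =
        norm (integral ?I (\<lambda>s. g'' s * cis (w * s))) / w\<^sup>2"
      by (simp add: norm_divide norm_power norm_mult)
    also have "\<dots> \<le> K * (2 * real L) / w\<^sup>2"
      using norm_integral_cis_le[of "-real L" "real L" g'' K w, OF _ cg'' K]
      by (intro divide_right_mono) auto
    finally show ?thesis using False by (simp add: w_def power_mult_distrib field_simps)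
  qed (simp add: C_def)
  have "(\<lambda>m::int. if m = 0 then C else 0) summable_on UNIV"
    by (rule finite_nonzero_values_imp_summable_on) auto
  hence "?b summable_on UNIV"
    by (intro summable_on_add summable_on_cmult_right summable_on_int_inverse_square)
  hence "(\<lambda>m::int. norm (integral ?I (\<lambda>s. g s * cis (2 * pi * of_int m * s)))) summable_on UNIV"
    by (rule summable_on_comparison_test) (use bound in auto)
  thus ?thesis by (rule abs_summable_summable)
qed

text \<open>Every finite set of integers lies in a symmetric interval, so the value of a sum known
  to exist can be read off from symmetric partial sums.\<close>

lemma filterlim_symmetric_int_intervals:
  "filterlim (\<lambda>M. {-int M..int M}) (finite_subsets_at_top UNIV) sequentially"
  unfolding filterlim_finite_subsets_at_top
proof (intro allI impI)
  fix X :: "int set" assume X: "finite X \<and> X \<subseteq> UNIV"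
  obtain K where K: "\<And>x. x \<in> X \<Longrightarrow> \<bar>x\<bar> \<le> K"
    using X finite_imageI[of X abs] Max_ge[of "abs ` X"] by blast
  show "\<forall>\<^sub>F M in sequentially. finite {-int M..int M} \<and> X \<subseteq> {-int M..int M} \<and> {-int M..int M} \<subseteq> UNIV"
    unfolding eventually_sequentially
    by (rule exI[of _ "nat K"]) (use K in \<open>force simp: abs_le_iff\<close>)
qed

text \<open>Decay of the coefficients shows that some sum \<open>S\<close> exists, and the symmetric
  partial sums identify it. The set \<open>K\<close> lets the caller name the integers at which
  \<open>g\<close> may be nonzero.\<close>

lemma poisson_summation_integers:
  fixes g :: "real \<Rightarrow> complex"
  assumes g: "\<And>s. (g has_vector_derivative g' s) (at s)"
    and g': "\<And>s. (g' has_vector_derivative g'' s) (at s)"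
    and g'': "continuous_on UNIV g''"
    and supp: "\<And>s. \<bar>s\<bar> > B \<Longrightarrow> g s = 0"
    and K: "finite K" "\<And>l. l \<notin> K \<Longrightarrow> g (of_int l) = 0"
  shows "((\<lambda>m::int. LINT s|lborel. g s * cis (2 * pi * of_int m * s)) has_sum (\<Sum>l\<in>K. g (of_int l))) UNIV"
proof -
  \<comment> \<open>The summand 1 puts the endpoints strictly outside \<open>[-B, B]\<close>, where
    \<open>g\<close> vanishes locally and hence \<open>g'\<close> vanishes too. This removes the
    boundary terms and the endpoint correction.\<close>
  define L where "L = nat \<lceil>B\<rceil> + 1"
  have L: "real L > B" unfolding L_def by linarith
  have g'0: "g' s = 0" if "\<bar>s\<bar> > B" for s
  proof -
    have "open {s::real. B < \<bar>s\<bar>}"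
      by (intro open_Collect_less continuous_intros)
    hence "(g has_vector_derivative 0) (at s)"
      by (rule has_vector_derivative_transform_within_open[OF has_vector_derivative_const])
         (use supp that in auto)
    thus ?thesis using vector_derivative_unique_at g by blast
  qed
  have cg: "continuous_on X g" for X
    by (rule continuous_on_vector_derivative[OF has_vector_derivative_at_within[OF g]])
  have g0: "g (real L) = 0" "g (- real L) = 0" "g' (real L) = 0" "g' (- real L) = 0"
    using supp g'0 L by auto
  define c where "c = (\<lambda>m::int. integral {-real L..real L} (\<lambda>s. g s * cis (2 * pi * of_int m * s)))"
  have c: "(LINT s|lborel. g s * cis (2 * pi * of_int m * s)) = c m" for m :: int
  proof -
    have "(LINT s|lborel. g s * cis (2 * pi * of_int m * s)) =
        (LINT s:{-real L..real L}|lborel. g s * cis (2 * pi * of_int m * s))"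
      unfolding set_lebesgue_integral_def
      by (intro Bochner_Integration.integral_cong refl) (use supp L in \<open>auto simp: indicator_def\<close>)
    also have "\<dots> = c m" unfolding c_def
      by (intro set_borel_integral_eq_integral borel_integrable_atLeastAtMost' continuous_intros cg)
    finally show ?thesis .
  qed
  have "c summable_on UNIV"
    unfolding c_def by (rule fourier_integral_summable[OF g g' g'' g0])
  then obtain S where S: "(c has_sum S) UNIV" by (auto simp: summable_on_def)
  have "(\<lambda>M. sum c {-int M..int M}) \<longlonglongrightarrow> S"
    using filterlim_compose[OF S[unfolded has_sum_def] filterlim_symmetric_int_intervals] .
  moreover have "(\<lambda>M. sum c {-int M..int M}) \<longlonglongrightarrow> (\<Sum>l=-int L..int L. g (of_int l))"
    using fourier_sum_symmetric_interval[OF g, of L] unfolding c_def by (simp add: g0)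
  ultimately have "S = (\<Sum>l=-int L..int L. g (of_int l))" by (rule LIMSEQ_unique)
  also have "\<dots> = (\<Sum>l\<in>K. g (of_int l))"
  proof (rule sum.mono_neutral_cong[OF K(1) finite_atLeastAtMost_int])
    fix l assume "l \<in> K - {-int L..int L}"
    hence "\<bar>of_int l :: real\<bar> > B" using L by (auto simp: not_le)
    thus "g (of_int l) = 0" by (rule supp)
  qed (use K in auto)
  finally show ?thesis using S unfolding c by simp
qed

text \<open>The substitution \<open>s = \<alpha> * t\<close> reduces to integer frequencies.
  Frequencies in \<open>\<alpha>\<int>\<close> correspond to sample points with spacing
  \<open>1 / \<alpha>\<close>, and the Jacobian is the factor \<open>1 / \<alpha>\<close>.\<close>

lemma poisson_summation:
  fixes f :: "real \<Rightarrow> complex"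
  assumes f: "\<And>t. (f has_vector_derivative f' t) (at t)"
    and f': "\<And>t. (f' has_vector_derivative f'' t) (at t)"
    and f'': "continuous_on UNIV f''"
    and supp: "\<And>t. \<bar>t\<bar> > B \<Longrightarrow> f t = 0"
    and \<alpha>: "\<alpha> > 0"
    and K: "finite K" "\<And>l. l \<notin> K \<Longrightarrow> f (of_int l / \<alpha>) = 0"
  shows "((\<lambda>m::int. LINT t|lborel. f t * cis (2 * pi * (of_int m * \<alpha>) * t)) has_sum
    (\<Sum>l\<in>K. f (of_int l / \<alpha>)) / of_real \<alpha>) UNIV"
proof -
  have d: "((\<lambda>s. h (s / \<alpha>)) has_vector_derivative h' (s / \<alpha>) / of_real \<alpha>) (at s)"
    if "\<And>t. (h has_vector_derivative h' t) (at t)" for h h' :: "real \<Rightarrow> complex" and s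
  proof -
    have "((\<lambda>s. s / \<alpha>) has_vector_derivative 1 / \<alpha>) (at s)"
      using \<alpha> by (auto intro!: derivative_eq_intros simp flip: has_real_derivative_iff_has_vector_derivative)
    from vector_diff_chain_at[OF this that] show ?thesis
      by (simp add: o_def scaleR_conv_of_real divide_inverse mult.commute)
  qed
  have 1: "((\<lambda>s. f (s / \<alpha>)) has_vector_derivative f' (s / \<alpha>) / of_real \<alpha>) (at s)" for s
    by (rule d[OF f])
  have 2: "((\<lambda>s. f' (s / \<alpha>) / of_real \<alpha>) has_vector_derivative f'' (s / \<alpha>) / of_real \<alpha> / of_real \<alpha>) (at s)" for s
    using has_vector_derivative_divide[OF d[OF f']] .
  have 3: "continuous_on UNIV (\<lambda>s. f'' (s / \<alpha>) / of_real \<alpha> / of_real \<alpha>)"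
    by (intro continuous_intros continuous_on_compose2[OF f'']) (use \<alpha> in auto)
  have 4: "f (s / \<alpha>) = 0" if "\<bar>s\<bar> > B * \<alpha>" for s
    by (rule supp) (use that \<alpha> in \<open>auto simp: field_simps\<close>)
  have "((\<lambda>m::int. LINT s|lborel. f (s / \<alpha>) * cis (2 * pi * of_int m * s)) has_sum
      (\<Sum>l\<in>K. f (of_int l / \<alpha>))) UNIV"
    by (rule poisson_summation_integers[OF 1 2 3 4 K])
  from has_sum_cmult_right[OF this, of "1 / of_real \<alpha>"]
  have "((\<lambda>m::int. 1 / of_real \<alpha> * (LINT s|lborel. f (s / \<alpha>) * cis (2 * pi * of_int m * s))) has_sum
      (\<Sum>l\<in>K. f (of_int l / \<alpha>)) / of_real \<alpha>) UNIV" by simp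
  moreover have "(LINT t|lborel. f t * cis (2 * pi * (of_int m * \<alpha>) * t)) =
     1 / of_real \<alpha> * (LINT s|lborel. f (s / \<alpha>) * cis (2 * pi * of_int m * s))" for m :: int
    using \<alpha> by (subst lborel_integral_real_affine[of "1 / \<alpha>" _ 0])
       (auto simp: scaleR_conv_of_real mult_ac)
  ultimately show ?thesis by simp
qed

section \<open>Divisor sums\<close>

lemma moebius_mu_1 [simp]: "moebius_mu 1 = 1" "moebius_mu (Suc 0) = 1"
  by (simp_all add: moebius_mu_def)

lemma moebius_mu_mult_coprime:
  assumes "coprime a b"
  shows "moebius_mu (a * b) = moebius_mu a * moebius_mu b"
proof (cases "squarefree a \<and> squarefree b")
  case True
  hence nz: "a \<noteq> 0" "b \<noteq> 0" by (metis not_squarefree_0)+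
  have "prime_factors (a * b) = prime_factors a \<union> prime_factors b"
    using nz by (rule prime_factors_product)
  moreover have "prime_factors a \<inter> prime_factors b = {}"
    using assms by (auto simp: in_prime_factors_iff dest: coprime_common_divisor)
  ultimately have "card (prime_factors (a * b)) = card (prime_factors a) + card (prime_factors b)"
    by (simp add: card_Un_disjoint)
  thus ?thesis using True squarefree_mult_coprime[OF assms]
    by (simp add: moebius_mu_def power_add)
next
  case False
  thus ?thesis using squarefree_multD[of a b] by (auto simp: moebius_mu_def)
qed

text \<open>A divisor of \<open>a * b\<close> splits as \<open>x * y\<close> in only one way,
  because \<open>x\<close> and \<open>y\<close> are recovered as its gcds with \<open>a\<close> and
  \<open>b\<close>.\<close>

lemma sum_divisors_mult_coprime:
  fixes f :: "nat \<Rightarrow> 'a::comm_monoid_add"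
  assumes "coprime a b"
  shows "(\<Sum>d | d dvd a * b. f d) = (\<Sum>x | x dvd a. \<Sum>y | y dvd b. f (x * y))"
proof -
  have gcds: "gcd (x * y) a = x" "gcd (x * y) b = y" if "x dvd a" "y dvd b" for x y
  proof -
    have "coprime a y" "coprime b x"
      using assms(1) that coprime_divisors[of a a y b] coprime_divisors[of b b x a]
      by (auto simp: coprime_commute)
    hence "gcd (x * y) a = gcd x a" "gcd (x * y) b = gcd y b"
      using gcd_mult_left_right_cancel[of a y x] gcd_mult_left_left_cancel[of b x y] by auto
    thus "gcd (x * y) a = x" "gcd (x * y) b = y"
      using that by (simp_all add: gcd_proj1_if_dvd)
  qed
  have inj: "inj_on (\<lambda>(x, y). x * y) ({x. x dvd a} \<times> {y. y dvd b})"
    by (intro inj_onI, clarify) (metis gcds)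
  have "{d. d dvd a * b} = (\<lambda>(x, y). x * y) ` ({x. x dvd a} \<times> {y. y dvd b})"
    by (auto intro: mult_dvd_mono dest!: division_decomp)
  thus ?thesis using sum.reindex[OF inj, of f]
    by (simp add: sum.cartesian_product case_prod_unfold)
qed

text \<open>Expansion of the product of the factors \<open>1 - p\<close>, by splitting off one prime
  at a time: the divisors of \<open>p * m\<close> are the \<open>y\<close> and the
  \<open>p * y\<close> with \<open>y\<close> dividing \<open>m\<close>, and
  \<open>moebius_mu (p * y) = - moebius_mu y\<close>, so the divisor sum acquires the factor
  \<open>1 - p\<close>.\<close>

lemma a_coeff_eq_sum_divisors:
  assumes "squarefree n"
  shows "a_coeff n = (\<Sum>d | d dvd n. moebius_mu d * int d)"
  using assms
proof (induction n rule: less_induct)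
  case (less n)
  show ?case
  proof (cases "n = 1")
    case True
    have "a_coeff 1 = 1" unfolding a_coeff_def by (rule prod.neutral) auto
    thus ?thesis by (simp add: True)
  next
    case False
    then obtain p where p: "prime p" "p dvd n" using prime_factor_nat by blast
    then obtain m where m: "n = p * m" by (auto simp: dvd_def)
    have m0: "m > 0" using less.prems m by (cases m) auto
    have "\<not> p dvd m"
      using squarefreeD[OF less.prems, of p] p(1) m by (auto simp: power2_eq_square)
    hence cop: "coprime p m" using p(1) prime_imp_coprime by blast
    have sqm: "squarefree m" using less.prems m squarefree_multD by blast
    have "m < n" using m m0 p(1) prime_gt_1_nat by simp
    note IH = less.IH[OF this sqm]
    have pset: "{q. prime q \<and> q dvd n} = insert p {q. prime q \<and> q dvd m}"
      using p(1) by (auto simp: m prime_dvd_mult_iff primes_dvd_imp_eq)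
    have fin: "finite {q. prime q \<and> q dvd m}"
      by (rule finite_subset[OF _ finite_divisors_nat[OF m0]]) auto
    have div_p: "{x. x dvd p} = {1, p}" and p1: "1 \<noteq> p"
      using p(1) by (auto simp: prime_nat_iff)
    have mu: "moebius_mu (p * y) = - moebius_mu y" if "y dvd m" for y
    proof -
      have "coprime p y" using cop that coprime_divisors[of p p y m] by simp
      moreover have "moebius_mu p = -1" using p(1)
        by (simp add: moebius_mu_def squarefree_prime prime_factorization_prime)
      ultimately show ?thesis by (simp add: moebius_mu_mult_coprime)
    qed
    have "(\<Sum>d | d dvd n. moebius_mu d * int d) =
        (\<Sum>y | y dvd m. moebius_mu y * int y) + (\<Sum>y | y dvd m. moebius_mu (p * y) * int (p * y))"
      unfolding m sum_divisors_mult_coprime[OF cop] div_p using p1 by simp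
    also have "(\<Sum>y | y dvd m. moebius_mu (p * y) * int (p * y)) =
        (\<Sum>y | y dvd m. - int p * (moebius_mu y * int y))"
      by (intro sum.cong) (auto simp: mu)
    also have "\<dots> = - int p * (\<Sum>y | y dvd m. moebius_mu y * int y)"
      by (rule sum_distrib_left[symmetric])
    also have "(\<Sum>y | y dvd m. moebius_mu y * int y) + - int p * (\<Sum>y | y dvd m. moebius_mu y * int y) =
        (1 - int p) * a_coeff m"
      unfolding IH by (simp add: algebra_simps)
    also have "\<dots> = a_coeff n"
      unfolding a_coeff_def pset using fin \<open>\<not> p dvd m\<close> by simp
    finally show ?thesis ..
  qed
qed

section \<open>The lattice sum\<close>

text \<open>With finitely many rows, unconditional convergence of each row already gives it on the
  product.\<close>

lemma has_sum_finite_rows: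
  fixes f :: "'a \<times> 'b \<Rightarrow> 'c::topological_comm_monoid_add"
  assumes "finite J" "\<And>j. j \<in> J \<Longrightarrow> ((\<lambda>k. f (j, k)) has_sum s j) K"
  shows "(f has_sum (\<Sum>j\<in>J. s j)) (J \<times> K)"
  using assms
proof (induction J)
  case (insert j J)
  have "(f has_sum s j) (Pair j ` K)"
    by (subst has_sum_reindex) (use insert.prems in \<open>auto simp: inj_on_def o_def\<close>)
  moreover have "(f has_sum (\<Sum>j\<in>J. s j)) (J \<times> K)" by (intro insert.IH insert.prems) auto
  ultimately have "(f has_sum s j + (\<Sum>j\<in>J. s j)) (Pair j ` K \<union> J \<times> K)"
    by (rule has_sum_Un_disjoint) (use insert.hyps in auto)
  moreover have "Pair j ` K \<union> J \<times> K = insert j J \<times> K" by auto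
  ultimately show ?case using insert.hyps by simp
qed simp

lemma has_sum_sum:
  fixes f :: "'i \<Rightarrow> 'a \<Rightarrow> 'c::topological_comm_monoid_add"
  assumes "\<And>i. i \<in> I \<Longrightarrow> (f i has_sum s i) A"
  shows "((\<lambda>x. \<Sum>i\<in>I. f i x) has_sum (\<Sum>i\<in>I. s i)) A"
  using assms by (induction I rule: infinite_finite_induct) (auto intro!: has_sum_add has_sum_0)

section \<open>Regularity and support of the integrand\<close>

lemma schwartz_derivatives:
  assumes "schwartz f"
  shows "(f has_vector_derivative vderiv f t) (at t)"
    and "(vderiv f has_vector_derivative vderiv (vderiv f) t) (at t)"
    and "continuous_on UNIV (vderiv (vderiv f))"
proof -
  have d: "(vderiv ^^ n) f differentiable (at x)" for n x
    using assms by (auto simp: schwartz_def)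
  have D: "((vderiv ^^ n) f has_vector_derivative (vderiv ^^ Suc n) f x) (at x)" for n x
    using d[of n x] by (simp add: vderiv_def[abs_def] vector_derivative_works)
  show "(f has_vector_derivative vderiv f t) (at t)" using D[of 0 t] by simp
  show "(vderiv f has_vector_derivative vderiv (vderiv f) t) (at t)" using D[of 1 t] by simp
  have "continuous_on UNIV ((vderiv ^^ 2) f)"
    by (intro differentiable_imp_continuous_on) (use d in \<open>auto simp: differentiable_on_def\<close>)
  thus "continuous_on UNIV (vderiv (vderiv f))" by (simp add: numeral_2_eq_2)
qed

text \<open>The derivative is a difference of two functions of the same shape, so the rule applies
  again to produce the second derivative required for Poisson summation.\<close>

lemma has_vector_derivative_cnj_mult_reflect:
  assumes p: "\<And>t. (p has_vector_derivative p' t) (at t)" and q: "\<And>t. (q has_vector_derivative q' t) (at t)"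
  shows "((\<lambda>t::real. cnj (p (X + t)) * q (X - t)) has_vector_derivative
    cnj (p' (X + t)) * q (X - t) - cnj (p (X + t)) * q' (X - t)) (at t)"
proof -
  have "((\<lambda>t. X + t) has_vector_derivative 1) (at t)" "((\<lambda>t. X - t) has_vector_derivative - 1) (at t)"
    by (auto intro!: derivative_eq_intros simp flip: has_real_derivative_iff_has_vector_derivative)
  from vector_diff_chain_at[OF this(1) p] vector_diff_chain_at[OF this(2) q]
  have "((\<lambda>t. p (X + t)) has_vector_derivative p' (X + t)) (at t)"
    and 2: "((\<lambda>t. q (X - t)) has_vector_derivative - q' (X - t)) (at t)"
    by (simp_all add: o_def)
  from has_vector_derivative_mult[OF has_vector_derivative_cnj[OF this(1)] 2] show ?thesis
    by simp
qed

text \<open>Fix \<open>x0\<close> and \<open>y0\<close> with \<open>v x0 \<noteq> 0\<close> and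
  \<open>u y0 \<noteq> 0\<close>. Pairing a general \<open>x\<close> with \<open>y0\<close> bounds
  \<open>x\<close>, and pairing \<open>x0\<close> with a general \<open>y\<close> bounds
  \<open>y\<close>. If no such points exist, any \<open>B\<close> will do.\<close>

lemma joint_support_bounded:
  fixes v u :: "real \<Rightarrow> complex"
  assumes "\<And>x y. v x * u y \<noteq> 0 \<Longrightarrow> x > 0 \<and> 0 < x\<^sup>2 - y\<^sup>2 \<and> x\<^sup>2 - y\<^sup>2 < 8"
  obtains B where "\<And>x y. v x * u y \<noteq> 0 \<Longrightarrow> \<bar>x\<bar> \<le> B \<and> \<bar>y\<bar> \<le> B"
proof (cases "\<exists>x y. v x * u y \<noteq> 0")
  case True
  then obtain x0 y0 where 0: "v x0 \<noteq> 0" "u y0 \<noteq> 0" by auto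
  show ?thesis
  proof (rule that)
    fix x y assume "v x * u y \<noteq> 0"
    hence "x\<^sup>2 \<le> 8 + y0\<^sup>2" "y\<^sup>2 \<le> x0\<^sup>2"
      using assms[of x y0] assms[of x0 y] 0 by auto
    hence "\<bar>x\<bar> \<le> sqrt (8 + y0\<^sup>2)" "\<bar>y\<bar> \<le> \<bar>x0\<bar>"
      using real_sqrt_le_mono[of "x\<^sup>2" "8 + y0\<^sup>2"] real_sqrt_le_mono[of "y\<^sup>2" "x0\<^sup>2"] by simp_all
    moreover have "0 \<le> sqrt (8 + y0\<^sup>2)" by simp
    ultimately show "\<bar>x\<bar> \<le> sqrt (8 + y0\<^sup>2) + \<bar>x0\<bar> \<and> \<bar>y\<bar> \<le> sqrt (8 + y0\<^sup>2) + \<bar>x0\<bar>"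
      by linarith
  qed
qed (use that in blast)

text \<open>The difference of squares is \<open>4 * n * l\<close>; strictly between 0 and 8 this
  forces \<open>n * l = 1\<close>, and positivity of the first coordinate rules out
  \<open>n = l = -1\<close>.\<close>

lemma lattice_points_in_support:
  fixes c :: real and n l :: int
  assumes "c > 0" "n * c + l / c > 0"
    and "0 < (n * c + l / c)\<^sup>2 - (n * c - l / c)\<^sup>2" "(n * c + l / c)\<^sup>2 - (n * c - l / c)\<^sup>2 < 8"
  shows "n = 1 \<and> l = 1"
proof -
  have "(n * c + l / c)\<^sup>2 - (n * c - l / c)\<^sup>2 = real_of_int (4 * (n * l))"
    using assms(1) by (simp add: power2_eq_square field_simps)
  hence "0 < n * l" "n * l < 2" using assms(3,4) by linarith+
  hence nl: "n * l = 1" by linarith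
  moreover have "\<not> (n = -1 \<and> l = -1)"
  proof
    assume "n = -1 \<and> l = -1"
    hence "c + 1 / c < 0" using assms(2) by simp
    moreover have "c + 1 / c > 0" using assms(1) by (intro add_pos_pos) auto
    ultimately show False by simp
  qed
  ultimately show ?thesis by (auto simp: zmult_eq_1_iff)
qed

lemma has_sum_sublattice:
  fixes v u :: "real \<Rightarrow> complex" and d :: nat and q :: real
  assumes v: "schwartz v" and u: "schwartz u"
    and supp: "\<And>x y. v x * u y \<noteq> 0 \<Longrightarrow> x > 0 \<and> 0 < x\<^sup>2 - y\<^sup>2 \<and> x\<^sup>2 - y\<^sup>2 < 8"
    and d: "d > 0" and q: "q > 0"
  defines "h \<equiv> \<lambda>(x, \<xi>). LINT t|lborel. cnj (v (x + t)) * u (x - t) * exp (2 * \<i> * of_real (pi * t * \<xi>))"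
  shows "((\<lambda>(j, k). h (of_int j / q, of_int k / q)) has_sum
      of_real (q / d) * (cnj (v (d / q + q / d)) * u (d / q - q / d)))
    ({j::int. int d dvd j} \<times> {k::int. int d dvd k})"
proof -
  obtain B where B: "\<And>x y. v x * u y \<noteq> 0 \<Longrightarrow> \<bar>x\<bar> \<le> B \<and> \<bar>y\<bar> \<le> B"
    using joint_support_bounded[OF supp] by blast
  define f where "f = (\<lambda>x t. cnj (v (x + t)) * u (x - t))"
  have f0: "f x t = 0" if "\<bar>x\<bar> > B \<or> \<bar>t\<bar> > B" for x t
  proof (rule ccontr)
    assume "f x t \<noteq> 0"
    hence "\<bar>x + t\<bar> \<le> B" "\<bar>x - t\<bar> \<le> B" using B[of "x + t" "x - t"] by (auto simp: f_def)
    thus False using that by linarith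
  qed
  \<comment> \<open>\<open>c\<close> is the spacing of the rescaled sublattice: its rows lie at
    \<open>x = n * c\<close>, and Poisson summation in \<open>\<xi>\<close> samples at
    \<open>t = l / c\<close>.\<close>
  define c where "c = d / q"
  have c: "c > 0" using d q by (simp add: c_def)
  have fnz: "n = 1 \<and> l = 1" if "f (of_int n * c) (of_int l / c) \<noteq> 0" for n l :: int
    using supp[of "of_int n * c + of_int l / c" "of_int n * c - of_int l / c"] that
    by (intro lattice_points_in_support[OF c]) (auto simp: f_def)
  define s where "s = f c (1 / c) / of_real c"
  have row: "((\<lambda>k. h (of_int j / q, of_int k / q)) has_sum (if j = int d then s else 0)) {k. int d dvd k}"
    if dj: "int d dvd j" for j
  proof -
    obtain n where n: "j = int d * n" using dj by (rule dvdE)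
    have j: "of_int j / q = of_int n * c" by (simp add: n c_def)
    note D = has_vector_derivative_cnj_mult_reflect[where X = "of_int j / q"]
    note dv = schwartz_derivatives[OF v] and du = schwartz_derivatives[OF u]
    note f1 = D[OF dv(1) du(1)]
    note f2 = has_vector_derivative_diff[OF D[OF dv(2) du(1)] D[OF dv(1) du(2)]]
    have cont: "continuous_on X v" "continuous_on X u" "continuous_on X (vderiv v)" "continuous_on X (vderiv u)" for X
      by (rule continuous_on_vector_derivative[OF has_vector_derivative_at_within], rule dv du)+
    note comp = continuous_on_compose2[OF cont(1)[of UNIV]] continuous_on_compose2[OF cont(2)[of UNIV]]
      continuous_on_compose2[OF cont(3)[of UNIV]] continuous_on_compose2[OF cont(4)[of UNIV]]
      continuous_on_compose2[OF dv(3)] continuous_on_compose2[OF du(3)]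
    \<comment> \<open>By \<open>fnz\<close>, in every row only the sample \<open>l = 1\<close> can
      be nonzero, so \<open>{1}\<close> serves as the set \<open>K\<close>.\<close>
    have "((\<lambda>m::int. LINT t|lborel. f (of_int j / q) t * cis (2 * pi * (of_int m * c) * t)) has_sum
        (\<Sum>l\<in>{1}. f (of_int j / q) (of_int l / c)) / of_real c) UNIV"
      unfolding f_def
    proof (rule poisson_summation[OF f1 f2 _ _ c])
      show "cnj (v (of_int j / q + t)) * u (of_int j / q - t) = 0" if "\<bar>t\<bar> > B" for t
        using f0[of "of_int j / q" t] that unfolding f_def by blast
      show "cnj (v (of_int j / q + of_int l / c)) * u (of_int j / q - of_int l / c) = 0" if "l \<notin> {1}" for l
        using fnz[of n l] that unfolding j f_def by auto
    qed (auto intro!: continuous_intros comp)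
    moreover have "(\<Sum>l\<in>{1}. f (of_int j / q) (of_int l / c)) / of_real c = (if j = int d then s else 0)"
    proof (cases "n = 1")
      case True
      thus ?thesis unfolding j by (simp add: s_def n)
    next
      case False
      thus ?thesis using fnz[of n 1] d unfolding j by (auto simp: n)
    qed
    moreover have "(LINT t|lborel. f (of_int j / q) t * cis (2 * pi * (of_int m * c) * t)) =
        h (of_int j / q, of_int (int d * m) / q)" for m
      unfolding h_def f_def c_def by (simp add: cis_conv_exp mult_ac)
    ultimately have "((\<lambda>m. h (of_int j / q, of_int (int d * m) / q)) has_sum (if j = int d then s else 0)) UNIV"
      by simp
    hence "((\<lambda>k. h (of_int j / q, of_int k / q)) has_sum (if j = int d then s else 0)) (range ((*) (int d)))"
      by (subst has_sum_reindex) (use d in \<open>auto simp: inj_on_def o_def\<close>)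
    moreover have "range ((*) (int d)) = {k. int d dvd k}" by (auto simp: dvd_def)
    ultimately show ?thesis by simp
  qed
  \<comment> \<open>Rows with \<open>\<bar>j / q\<bar> > B\<close> have zero integrand. Row
    \<open>d\<close> is included by hand, so that the sum over \<open>J\<close> equals
    \<open>s\<close> whether or not \<open>d / q\<close> exceeds \<open>B\<close>.\<close>
  define J where "J = {j. int d dvd j \<and> (j = int d \<or> \<bar>j\<bar> \<le> \<lceil>B * q\<rceil>)}"
  have finJ: "finite J"
    by (rule finite_subset[of _ "insert (int d) {-\<lceil>B * q\<rceil>..\<lceil>B * q\<rceil>}"]) (auto simp: J_def)
  have "((\<lambda>(j, k). h (of_int j / q, of_int k / q)) has_sum (\<Sum>j\<in>J. if j = int d then s else 0))
      (J \<times> {k. int d dvd k})"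
    by (rule has_sum_finite_rows[OF finJ]) (use row in \<open>auto simp: J_def\<close>)
  also have "(\<Sum>j\<in>J. if j = int d then s else 0) = s"
    using finJ by (subst sum.delta) (auto simp: J_def)
  also have "((\<lambda>(j, k). h (of_int j / q, of_int k / q)) has_sum s) (J \<times> {k. int d dvd k}) \<longleftrightarrow>
    ((\<lambda>(j, k). h (of_int j / q, of_int k / q)) has_sum s) ({j. int d dvd j} \<times> {k. int d dvd k})"
  proof (rule has_sum_cong_neutral)
    fix p assume "p \<in> {j. int d dvd j} \<times> {k. int d dvd k} - J \<times> {k. int d dvd k}"
    then obtain j k where p: "p = (j, k)" "\<not> \<bar>j\<bar> \<le> \<lceil>B * q\<rceil>" by (auto simp: J_def)
    have "B * q < \<bar>of_int j\<bar>" using p(2) by linarith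
    hence "B < \<bar>of_int j / q\<bar>" using q by (simp add: field_simps)
    hence z: "cnj (v (of_int j / q + t)) * u (of_int j / q - t) = 0" for t
      using f0[of "of_int j / q" t] by (simp add: f_def)
    show "(case p of (j, k) \<Rightarrow> h (of_int j / q, of_int k / q)) = 0"
      unfolding p h_def prod.case z by simp
  qed (auto simp: J_def)
  finally show ?thesis by (simp add: s_def f_def c_def mult_ac)
qed

text \<open>Writing the coefficient over the fixed index set of divisors of \<open>N\<close> lets
  the divisor sum be exchanged with the lattice sum. At \<open>j = k = 0\<close> all divisors occur,
  in accordance with \<open>gcd(0, 0, N) = N\<close>.\<close>

lemma a_coeff_gcd:
  fixes N :: nat and j k :: int
  assumes "squarefree N"
  shows "a_coeff (nat (gcd (gcd j k) (int N))) =
    (\<Sum>d | d dvd N. if int d dvd j \<and> int d dvd k then moebius_mu d * int d else 0)"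
proof -
  define n where "n = nat (gcd (gcd j k) (int N))"
  have n: "int n = gcd (gcd j k) (int N)" by (simp add: n_def)
  have dvd: "d dvd n \<longleftrightarrow> d dvd N \<and> int d dvd j \<and> int d dvd k" for d
  proof -
    have "d dvd n \<longleftrightarrow> int d dvd int n" by simp
    thus ?thesis unfolding n by auto
  qed
  have N0: "N > 0" using assms by (metis gr0I not_squarefree_0)
  have "n dvd N" using dvd[of n] by simp
  hence "squarefree n" using assms by (rule squarefree_mono)
  hence "a_coeff n = (\<Sum>d | d dvd n. moebius_mu d * int d)" by (rule a_coeff_eq_sum_divisors)
  also have "\<dots> = (\<Sum>d | d dvd N. if int d dvd j \<and> int d dvd k then moebius_mu d * int d else 0)"
    by (rule sum.mono_neutral_cong_left) (use N0 in \<open>auto simp: dvd\<close>)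
  finally show ?thesis by (simp add: n_def)
qed

theorem theorem8p4:
  fixes N R Q :: nat and v u :: "real \<Rightarrow> complex"
  assumes "N = R * Q" and "R > 0" and "Q > 0"
    and "squarefree N" and "odd N"
    and "[R = 1] (mod (2 * Q\<^sup>2))"
    and "schwartz v" and "schwartz u"
    and "\<And>x y. v x * u y \<noteq> 0 \<Longrightarrow> x > 0 \<and> 0 < x\<^sup>2 - y\<^sup>2 \<and> x\<^sup>2 - y\<^sup>2 < 8"
  shows "sesq v (Psi (dilate (real Q) (T_distr N)) u) =
    (\<Sum>(Q1, Q2)\<in>{(Q1, Q2). Q1 * Q2 = Q}. of_int (moebius_mu Q1) *
       (\<Sum>R1\<in>{R1. R1 dvd R}. of_int (moebius_mu R1) *
          cnj (v (real R1 / real Q2 + real Q2 / real R1)) *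
          u (real R1 / real Q2 - real Q2 / real R1)))"
proof -
  define h where "h = (\<lambda>(x, \<xi>). LINT t|lborel. cnj (v (x + t)) * u (x - t) * exp (2 * \<i> * of_real (pi * t * \<xi>)))"
  define H where "H = (\<lambda>(j::int, k::int). h (of_int j / real Q, of_int k / real Q))"
  define G where "G = (\<lambda>d::nat. cnj (v (d / Q + Q / d)) * u (real d / Q - real Q / d))"
  have N0: "N > 0" using assms(1-3) by simp
  \<comment> \<open>The sublattice sum is extended by zero to all pairs. The weight \<open>d\<close>
    cancels the density \<open>Q / d\<close> up to a factor \<open>Q\<close> common to all
    \<open>d\<close>.\<close>
  have sub: "((\<lambda>(j, k). if int d dvd j \<and> int d dvd k then of_int (moebius_mu d) * of_nat d * H (j, k) else 0)
      has_sum of_nat Q * (of_int (moebius_mu d) * G d)) UNIV" if "d dvd N" for d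
  proof -
    have d: "d > 0" using that N0 by (auto intro: Nat.gr0I)
    have "(H has_sum of_real (Q / d) * G d) ({j. int d dvd j} \<times> {k. int d dvd k})"
      using has_sum_sublattice[OF assms(7-9) d, of "real Q"] assms(3)
      by (simp add: H_def G_def h_def)
    from has_sum_cmult_right[OF this, of "of_int (moebius_mu d) * of_nat d"]
    have "((\<lambda>p. of_int (moebius_mu d) * of_nat d * H p) has_sum of_nat Q * (of_int (moebius_mu d) * G d))
        ({j. int d dvd j} \<times> {k. int d dvd k})"
      using d by (simp add: mult_ac)
    thus ?thesis
      by (rule has_sum_cong_neutral[THEN iffD1, rotated -1]) (auto split: if_splits)
  qed
  have "((\<lambda>p. \<Sum>d | d dvd N. case p of (j, k) \<Rightarrow>
        if int d dvd j \<and> int d dvd k then of_int (moebius_mu d) * of_nat d * H (j, k) else 0)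
      has_sum (\<Sum>d | d dvd N. of_nat Q * (of_int (moebius_mu d) * G d))) UNIV"
    by (rule has_sum_sum) (use sub in auto)
  also have "(\<lambda>p. \<Sum>d | d dvd N. case p of (j, k) \<Rightarrow>
        if int d dvd j \<and> int d dvd k then of_int (moebius_mu d) * of_nat d * H (j, k) else 0) =
      (\<lambda>(j, k). of_int (a_coeff (nat (gcd (gcd j k) (int N)))) * H (j, k))"
    by (auto simp: fun_eq_iff a_coeff_gcd[OF assms(4)] sum_distrib_right of_int_sum intro!: sum.cong)
  finally have "T_distr N (\<lambda>(x, \<xi>). h (x / real Q, \<xi> / real Q)) = of_nat Q * (\<Sum>d | d dvd N. of_int (moebius_mu d) * G d)"
    unfolding T_distr_def H_def by (simp add: infsumI sum_distrib_left)
  \<comment> \<open>The dilation contributes \<open>Q / Q^2\<close>, which removes the common factor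
    \<open>Q\<close>.\<close>
  hence lhs: "sesq v (Psi (dilate (real Q) (T_distr N)) u) = (\<Sum>d | d dvd N. of_int (moebius_mu d) * G d)"
    using assms(3) by (simp add: sesq_def Psi_def dilate_def h_def power2_eq_square)
  have cop: "coprime Q R"
  proof (rule coprimeI)
    fix x assume "x dvd Q" "x dvd R"
    hence "x\<^sup>2 dvd N" unfolding assms(1) power2_eq_square by (simp add: mult_dvd_mono)
    thus "is_unit x" by (rule squarefreeD[OF assms(4)])
  qed
  have "(\<Sum>d | d dvd N. of_int (moebius_mu d) * G d) =
      (\<Sum>x | x dvd Q. \<Sum>y | y dvd R. of_int (moebius_mu (x * y)) * G (x * y))"
    unfolding assms(1) mult.commute[of R] by (rule sum_divisors_mult_coprime[OF cop])
  also have "\<dots> = (\<Sum>x | x dvd Q. of_int (moebius_mu x) *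
       (\<Sum>y | y dvd R. of_int (moebius_mu y) *
          cnj (v (real y / real (Q div x) + real (Q div x) / real y)) *
          u (real y / real (Q div x) - real (Q div x) / real y)))"
    unfolding sum_distrib_left
  proof (intro sum.cong refl)
    fix x y assume "x \<in> {x. x dvd Q}" "y \<in> {y. y dvd R}"
    hence x: "x dvd Q" and y: "y dvd R" by auto
    \<comment> \<open>With \<open>Q1 = x\<close>, \<open>Q2 = Q div x\<close> and
      \<open>R1 = y\<close>, the factor \<open>x\<close> cancels from \<open>d / Q\<close>.\<close>
    have "real (x * y) / real Q = real y / real (Q div x)" "real Q / real (x * y) = real (Q div x) / real y"
      using x assms(3) by (auto elim!: dvdE)
    moreover have "coprime x y" using coprime_divisors[OF x y cop] .
    ultimately show "of_int (moebius_mu (x * y)) * G (x * y) = of_int (moebius_mu x) *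
        (of_int (moebius_mu y) * cnj (v (real y / real (Q div x) + real (Q div x) / real y)) *
          u (real y / real (Q div x) - real (Q div x) / real y))"
      by (simp only: G_def moebius_mu_mult_coprime of_int_mult mult.assoc)
  qed
  also have "\<dots> = (\<Sum>(Q1, Q2)\<in>{(Q1, Q2). Q1 * Q2 = Q}. of_int (moebius_mu Q1) *
       (\<Sum>R1\<in>{R1. R1 dvd R}. of_int (moebius_mu R1) *
          cnj (v (real R1 / real Q2 + real Q2 / real R1)) *
          u (real R1 / real Q2 - real Q2 / real R1)))"
    by (rule sum.reindex_bij_witness[where i = fst and j = "\<lambda>x. (x, Q div x)"]) (use assms(3) in auto)
  finally show ?thesis unfolding lhs .
qed

end
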